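(* Let $V$ be a finite set, $\Sigma$ a finite alphabet, and let $\rho,\delta,\lambda,\alpha\ge 0$ satisfy $\lambda\le \frac{\rho\delta\alpha}{64}$. Let $X=(V,T,K,S)$ be a multilayer agreement sampler with sampler parameter $\lambda$, ensemble parameter $\delta$ and soundness parameter $\alpha$ (as defined in the context). Let $\{C_t\}_{t\in T}$, $C_t\subseteq \Sigma^t$, be base codes, and let $$C=\{w:V\to\Sigma \;:\; w|_t\in C_t \text{ for all } t\in T\},$$ and for $k\in K$, $s\in S$ let $C_k=\{w:k\to\Sigma : w|_t\in C_t \ \forall t\in T,\ t\subseteq k\}$ and $C_s=\{w:s\to\Sigma : w|_t\in C_t\ \forall t\in T,\ t\subseteq s\}$. Suppose: 1. (Local distance) for every $k\in K$, the code $C_k$ has relative distance at least $\delta$; 2. (Local local testability) for every $s\in S$, the code $C_s$ is $\rho$-locally testable with respect to sampling $t\in T$ conditioned on $t\subseteq s$ (i.e. from the conditional distribution of $t$ given $s$ in the Markov chain), meaning $\rho\cdot\mathrm{dist}(f,C_s)\le \Pr_{t\mid s}[f|_t\notin C_t]$ for every $f:s\to\Sigma$. Then $C$ is $\frac{\rho\delta\alpha}{16}$-locally testable with respect to the distribution of choosing $t\in T$ (the marginal of $t$ in the Markov chain), i.e. for every $w:V\to\Sigma$, $$\frac{\rho\delta\alpha}{16}\cdot \mathrm{dist}(w,C)\le \Pr_{t}[w|_t\notin C_t].$$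
   Context: Distances are relative Hamming distances: for functions $f,g$ on a finite set $A$, $\mathrm{dist}(f,g)$ is the fraction of $x\in A$ with $f(x)\neq g(x)$; $\mathrm{dist}(f,C)=\min_{g\in C}\mathrm{dist}(f,g)$, and the (relative) distance of a code is the minimum distance between two distinct codewords. Multilayer agreement sampler (MAS): $V$ is a finite set and $T,K,S$ are families of subsets of $V$, together with a non-degenerate Markov chain, i.e. a probability distribution on tuples $(v,t,k,s)\in V\times T\times K\times S$ with $v\in t\subseteq k\subseteq s$, in which the choice of $t$ depends only on $v$, the choice of $k$ depends only on $t$, and the choice of $s$ depends only on $k$. $X$ is a MAS with sampler parameter $\lambda$, ensemble parameter $\delta$ and soundness parameter $\alpha$ if: (i) There is a non-negatively weighted graph $\mathcal{A}$ (weights summing to 1) on vertex set $S$, each edge $\{s,s'\}$ labelled by some $k\in K$ with $k\subseteq s\cap s'$ (written $\{s,s'\}_k$), such that sampling a labelled edge $\{s,s'\}_k$ according to the weights and returning $(s,k)$ gives the same distribution as the marginal of $(s,k)$ in the Markov chain. For an ensemble $\{f_s\}_{s\in S}$, $f_s:s\to\Sigma$, its value is $\mathcal{A}(\{f_s\})=\Pr_{\{s,s'\}_k\sim\mathcal{A}}[f_s|_k=f_{s'}|_k]$. The ensemble is a $\delta$-ensemble if for every edge $\{s,s'\}_k$ either $f_s|_k=f_{s'}|_k$ or $f_s|_k$ and $f_{s'}|_k$ differ in at least $\delta|k|$ positions. It is required that $\mathcal{A}$ be $(K,\alpha)$-sound for $\delta$-ensembles: for every $\delta$-ensemble $\{f_s\}$,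 $$\alpha\cdot\min_{G:V\to\Sigma}\Pr_{(s,k)}[f_s|_k\neq G|_k]\le 1-\mathcal{A}(\{f_s\}),$$ where $(s,k)$ is drawn from the Markov chain marginal. (ii) The bipartite containment graph between $K$ and $T$, where the pair $(k,t)$ has weight equal to the probability of $(t,k)$ in the Markov chain, is a $\lambda$-sampler: for every $B\subseteq K$ and every $\eta>0$, letting $N=\{t\in T: \Pr[k\in B\mid t]>\Pr[B]+\eta\}$ (with $k$ a random neighbor of $t$ drawn from the conditional distribution and $\Pr[B]$ under the marginal on $K$), one has $\Pr[N]\le \frac{\lambda}{\eta^2}\Pr[B]$ (with $\Pr[N]$ under the marginal on $T$).
   Formalization: The formal theorem also assumes that C is nonempty, δ ≤ 1, α ≤ 2, and that in the Markov chain v is uniform in V, uniform in k given k, and uniform in s given s; without these the claim is undefined or fails. *)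

theory Defs
  imports "HOL-Probability.Probability"
begin

section \<open>Relative Hamming distance and codes\<close>

text \<open>
  A word on a finite set \<open>A\<close> over the alphabet \<open>\<Sigma>\<close> is an element of \<open>A \<rightarrow>\<^sub>E \<Sigma>\<close>; the restriction of
  a word to a subset is taken with \<open>restrict\<close>.
\<close>

definition hdist :: "'v set \<Rightarrow> ('v \<Rightarrow> 'a) \<Rightarrow> ('v \<Rightarrow> 'a) \<Rightarrow> real" where
  "hdist A f g = real (card {x \<in> A. f x \<noteq> g x}) / real (card A)"

text \<open>The minimum is only meaningful for a finite nonempty code.\<close>

definition hdist_code :: "'v set \<Rightarrow> ('v \<Rightarrow> 'a) \<Rightarrow> ('v \<Rightarrow> 'a) set \<Rightarrow> real" where
  "hdist_code A f C = Min (hdist A f ` C)"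

text \<open>A code with at most one codeword satisfies this for every \<open>\<delta>\<close>.\<close>

definition rel_distance_at_least :: "'v set \<Rightarrow> ('v \<Rightarrow> 'a) set \<Rightarrow> real \<Rightarrow> bool" where
  "rel_distance_at_least A C \<delta> \<longleftrightarrow> (\<forall>f\<in>C. \<forall>g\<in>C. f \<noteq> g \<longrightarrow> \<delta> \<le> hdist A f g)"

text \<open>
  The code on \<open>A\<close> cut out by the base codes \<open>B t\<close> of those \<open>t \<in> T\<close> that lie inside \<open>A\<close>. It is
  used for \<open>A = k\<close>, for \<open>A = s\<close>, and for \<open>A = V\<close>, where \<open>t \<subseteq> V\<close> holds for all \<open>t \<in> T\<close>.
\<close>

definition code_on ::
  "'a set \<Rightarrow> 'v set set \<Rightarrow> ('v set \<Rightarrow> ('v \<Rightarrow> 'a) set) \<Rightarrow> 'v set \<Rightarrow> ('v \<Rightarrow> 'a) set" where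
  "code_on \<Sigma> T B A = {w \<in> A \<rightarrow>\<^sub>E \<Sigma>. \<forall>t\<in>T. t \<subseteq> A \<longrightarrow> restrict w t \<in> B t}"

text \<open>Here \<open>\<tau>\<close> is the distribution of the set \<open>t\<close> that the tester queries.\<close>

definition locally_testable ::
  "'a set \<Rightarrow> ('v set \<Rightarrow> ('v \<Rightarrow> 'a) set) \<Rightarrow> 'v set \<Rightarrow> ('v \<Rightarrow> 'a) set \<Rightarrow> 'v set pmf \<Rightarrow> real \<Rightarrow> bool" where
  "locally_testable \<Sigma> B A C \<tau> \<rho> \<longleftrightarrow>
     (\<forall>f \<in> A \<rightarrow>\<^sub>E \<Sigma>.
        \<rho> * hdist_code A f C \<le> measure_pmf.prob \<tau> {t. restrict f t \<notin> B t})"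

section \<open>The Markov chain\<close>

type_synonym 'v chain = "('v \<times> 'v set \<times> 'v set \<times> 'v set) pmf"

fun v_of :: "'v \<times> 'v set \<times> 'v set \<times> 'v set \<Rightarrow> 'v" where "v_of (v, t, k, s) = v"
fun t_of :: "'v \<times> 'v set \<times> 'v set \<times> 'v set \<Rightarrow> 'v set" where "t_of (v, t, k, s) = t"
fun k_of :: "'v \<times> 'v set \<times> 'v set \<times> 'v set \<Rightarrow> 'v set" where "k_of (v, t, k, s) = k"
fun s_of :: "'v \<times> 'v set \<times> 'v set \<times> 'v set \<Rightarrow> 'v set" where "s_of (v, t, k, s) = s"

definition markov :: "'v chain \<Rightarrow> bool" where
  "markov P \<longleftrightarrow>
     (\<exists>p0 p1 p2 p3.
        P = bind_pmf p0 (\<lambda>v. bind_pmf (p1 v) (\<lambda>t. bind_pmf (p2 t) (\<lambda>k.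
              map_pmf (\<lambda>s. (v, t, k, s)) (p3 k)))))"

text \<open>
  Non-degeneracy: every element of every layer has positive probability. In particular all
  distributions conditioned on a layer element are defined.
\<close>

definition nondegenerate ::
  "'v chain \<Rightarrow> 'v set \<Rightarrow> 'v set set \<Rightarrow> 'v set set \<Rightarrow> 'v set set \<Rightarrow> bool" where
  "nondegenerate P V T K S \<longleftrightarrow>
     v_of ` set_pmf P = V \<and> t_of ` set_pmf P = T \<and> k_of ` set_pmf P = K \<and> s_of ` set_pmf P = S"

definition layered_chain ::
  "'v chain \<Rightarrow> 'v set \<Rightarrow> 'v set set \<Rightarrow> 'v set set \<Rightarrow> 'v set set \<Rightarrow> bool" where
  "layered_chain P V T K S \<longleftrightarrow>
     T \<subseteq> Pow V \<and> K \<subseteq> Pow V \<and> S \<subseteq> Pow V \<and>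
     (\<forall>(v, t, k, s) \<in> set_pmf P.
        v \<in> V \<and> t \<in> T \<and> k \<in> K \<and> s \<in> S \<and> v \<in> t \<and> t \<subseteq> k \<and> k \<subseteq> s) \<and>
     markov P \<and> nondegenerate P V T K S"

text \<open>
  The chain samples vertices uniformly, from \<open>V\<close> and inside each \<open>k\<close> and each \<open>s\<close>. This is what
  makes the (unweighted) relative Hamming distances on \<open>V\<close>, \<open>k\<close> and \<open>s\<close> averages of one another
  along the chain.
\<close>

definition uniform_vertices :: "'v chain \<Rightarrow> 'v set \<Rightarrow> 'v set set \<Rightarrow> 'v set set \<Rightarrow> bool" where
  "uniform_vertices P V K S \<longleftrightarrow>
     map_pmf v_of P = pmf_of_set V \<and>
     (\<forall>k\<in>K. map_pmf v_of (cond_pmf P {x. k_of x = k}) = pmf_of_set k) \<and>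
     (\<forall>s\<in>S. map_pmf v_of (cond_pmf P {x. s_of x = s}) = pmf_of_set s)"

section \<open>Agreement testers\<close>

text \<open>
  A labelled edge \<open>{s, s'}\<^sub>k\<close> is represented as the pair \<open>(e, k)\<close> with \<open>e = {s, s'}\<close>. Loops
  (\<open>s = s'\<close>) are allowed, and so are edges of weight \<open>0\<close>. Sampling an edge and returning
  \<open>(s, k)\<close> means returning a uniformly random endpoint of the unordered edge.
\<close>

type_synonym 'v edge = "'v set set \<times> 'v set"

definition agreement_graph ::
  "'v chain \<Rightarrow> 'v set set \<Rightarrow> 'v set set \<Rightarrow> 'v edge set \<Rightarrow> 'v edge pmf \<Rightarrow> bool" where
  "agreement_graph P K S E W \<longleftrightarrow>
     (\<forall>(e, k)\<in>E. (\<exists>s\<in>S. \<exists>s'\<in>S. e = {s, s'} \<and> k \<in> K \<and> k \<subseteq> s \<inter> s')) \<and>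
     set_pmf W \<subseteq> E \<and>
     bind_pmf W (\<lambda>(e, k). map_pmf (\<lambda>s. (s, k)) (pmf_of_set e)) = map_pmf (\<lambda>x. (s_of x, k_of x)) P"

definition agrees :: "('v set \<Rightarrow> 'v \<Rightarrow> 'a) \<Rightarrow> 'v edge \<Rightarrow> bool" where
  "agrees f = (\<lambda>(e, k). \<forall>s\<in>e. \<forall>s'\<in>e. restrict (f s) k = restrict (f s') k)"

definition agreement_value :: "'v edge pmf \<Rightarrow> ('v set \<Rightarrow> 'v \<Rightarrow> 'a) \<Rightarrow> real" where
  "agreement_value W f = measure_pmf.prob W {x. agrees f x}"

definition ensemble :: "'a set \<Rightarrow> 'v set set \<Rightarrow> ('v set \<Rightarrow> 'v \<Rightarrow> 'a) \<Rightarrow> bool" where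
  "ensemble \<Sigma> S f \<longleftrightarrow> (\<forall>s\<in>S. f s \<in> s \<rightarrow>\<^sub>E \<Sigma>)"

definition delta_ensemble ::
  "'a set \<Rightarrow> 'v set set \<Rightarrow> 'v edge set \<Rightarrow> real \<Rightarrow> ('v set \<Rightarrow> 'v \<Rightarrow> 'a) \<Rightarrow> bool" where
  "delta_ensemble \<Sigma> S E \<delta> f \<longleftrightarrow>
     ensemble \<Sigma> S f \<and>
     (\<forall>(e, k)\<in>E. \<forall>s s'. e = {s, s'} \<longrightarrow>
        restrict (f s) k = restrict (f s') k \<or>
        \<delta> * real (card k) \<le> real (card {x \<in> k. f s x \<noteq> f s' x}))"

definition sound_for_delta_ensembles ::
  "'v chain \<Rightarrow> 'v set \<Rightarrow> 'v set set \<Rightarrow> 'v edge set \<Rightarrow> 'v edge pmf \<Rightarrow> 'a set \<Rightarrow> real \<Rightarrow> real \<Rightarrow> bool"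
where
  "sound_for_delta_ensembles P V S E W \<Sigma> \<delta> \<alpha> \<longleftrightarrow>
     (\<forall>f. delta_ensemble \<Sigma> S E \<delta> f \<longrightarrow>
        \<alpha> * Min ((\<lambda>G. measure_pmf.prob P {x. restrict (f (s_of x)) (k_of x) \<noteq> restrict G (k_of x)})
                  ` (V \<rightarrow>\<^sub>E \<Sigma>))
          \<le> 1 - agreement_value W f)"

section \<open>Samplers\<close>

text \<open>
  \<open>Q\<close> is the edge distribution on pairs \<open>(t, k)\<close>, with \<open>\<lambda> = l\<close>.
\<close>

definition is_sampler :: "('v set \<times> 'v set) pmf \<Rightarrow> 'v set set \<Rightarrow> 'v set set \<Rightarrow> real \<Rightarrow> bool" where
  "is_sampler Q T K l \<longleftrightarrow>
     (\<forall>B \<eta>. B \<subseteq> K \<and> \<eta> > 0 \<longrightarrow>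
        (let pB = measure_pmf.prob (map_pmf snd Q) B;
             N = {t \<in> T. measure_pmf.prob (map_pmf snd (cond_pmf Q {y. fst y = t})) B > pB + \<eta>}
         in measure_pmf.prob (map_pmf fst Q) N \<le> l / \<eta>\<^sup>2 * pB))"

section \<open>Multilayer agreement samplers\<close>

definition is_MAS ::
  "'v chain \<Rightarrow> 'v set \<Rightarrow> 'v set set \<Rightarrow> 'v set set \<Rightarrow> 'v set set \<Rightarrow> 'a set \<Rightarrow>
     real \<Rightarrow> real \<Rightarrow> real \<Rightarrow> bool" where
  "is_MAS P V T K S \<Sigma> l \<delta> \<alpha> \<longleftrightarrow>
     layered_chain P V T K S \<and>
     (\<exists>E W. agreement_graph P K S E W \<and> sound_for_delta_ensembles P V S E W \<Sigma> \<delta> \<alpha>) \<and>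
     is_sampler (map_pmf (\<lambda>x. (t_of x, k_of x)) P) T K l"

end

(*
  Given a word w that violates an eps-fraction of the base codes, let f_s be the codeword of C_s
  nearest to w|_s. Local testability bounds the average of dist(f_s, w|_s) by eps/rho. Two
  codewords of C_k that disagree are delta-far apart, so the f_s form a delta-ensemble with
  disagreement at most 2 eps/(rho delta), and soundness yields G with Pr[f_s|_k <> G|_k] at most
  beta = 2 eps/(rho delta alpha). Hence G is close to w, and G|_k is a codeword for all but a
  beta-fraction of the k. A base code violated by G spoils every k above it, so the sampler
  property with eta = 1/2 shows that G violates at most a 4 lambda beta <= eps/8 fraction of them.
  A word w that contradicts the theorem with eps minimal is therefore impossible: its correction G
  is no counterexample, and the triangle inequality through G bounds dist(w, C).
*)

theory Submission
  imports Defs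
begin

section \<open>Expectations and conditioning for discrete distributions\<close>

text \<open>Boundedness supplies the integrability that the general rule for integrals over a bind
  asks for; probabilities and Hamming distances both satisfy it with bound 1.\<close>

lemma integral_bind_pmf_bounded:
  fixes f :: "'b \<Rightarrow> real"
  assumes "\<And>x. \<bar>f x\<bar> \<le> b"
  shows "measure_pmf.expectation (bind_pmf p N) f =
    measure_pmf.expectation p (\<lambda>x. measure_pmf.expectation (N x) f)"
  unfolding measure_pmf_bind
  by (rule integral_bind[where K = "count_space UNIV" and B = b and B' = 1])
     (use assms measurable_measure_pmf[of N] in
       \<open>auto simp: measure_pmf.emeasure_space_1 measure_pmf.finite_measure\<close>)

lemma prob_bind_pmf:
  "measure_pmf.prob (bind_pmf p N) A = measure_pmf.expectation p (\<lambda>x. measure_pmf.prob (N x) A)"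
  using integral_bind_pmf_bounded[of "indicator A" 1 p N] by (auto simp: indicator_def)

text \<open>Law of total probability at the level of distributions: drawing the value of
  \<open>f\<close> first and then conditioning on it recovers \<open>p\<close>.\<close>

lemma bind_map_cond_pmf:
  "bind_pmf (map_pmf f p) (\<lambda>y. cond_pmf p {x. f x = y}) = p"
proof (rule bind_cond_pmf_cancel)
  fix x y assume "f y = x"
  then show "measure_pmf.prob p {y. f y = x} = measure_pmf.prob (map_pmf f p) {x. f y = x}"
    by (auto intro!: arg_cong[where f = "measure_pmf.prob p"])
qed auto

text \<open>The value conditioned on is that of an independent sample \<open>z\<close>, so
  inequalities between conditional probabilities can be averaged directly over
  \<open>p\<close>.\<close>

lemma prob_conditioned:
  "measure_pmf.prob p A =
    measure_pmf.expectation p (\<lambda>z. measure_pmf.prob (cond_pmf p {x. f x = f z}) A)"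
  by (subst bind_map_cond_pmf[of f p, symmetric]) (simp add: prob_bind_pmf)

section \<open>Hamming distances and codes\<close>

lemma prob_pmf_of_set_eq_hdist:
  assumes "finite A" "A \<noteq> {}"
  shows "measure_pmf.prob (pmf_of_set A) {v. f v \<noteq> g v} = hdist A f g"
  using assms by (simp add: measure_pmf_of_set hdist_def Int_def conj_commute)

lemma hdist_nonneg: "0 \<le> hdist A f g"
  by (simp add: hdist_def)

lemma hdist_le_1: "hdist A f g \<le> 1"
proof (cases "finite A")
  case True
  then have "card {x \<in> A. f x \<noteq> g x} \<le> card A"
    by (intro card_mono) auto
  then show ?thesis
    by (cases "card A = 0") (simp_all add: hdist_def)
qed (simp add: hdist_def)

lemma hdist_triangle:
  assumes "finite A"
  shows "hdist A f h \<le> hdist A f g + hdist A g h"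
proof -
  have "card {x \<in> A. f x \<noteq> h x} \<le> card ({x \<in> A. f x \<noteq> g x} \<union> {x \<in> A. g x \<noteq> h x})"
    using assms by (intro card_mono) auto
  also have "\<dots> \<le> card {x \<in> A. f x \<noteq> g x} + card {x \<in> A. g x \<noteq> h x}"
    by (rule card_Un_le)
  finally show ?thesis
    unfolding hdist_def add_divide_distrib[symmetric]
    by (intro divide_right_mono) (simp_all flip: of_nat_add)
qed

lemma hdist_commute: "hdist A f g = hdist A g f"
  by (simp add: hdist_def eq_commute)

lemma hdist_restrict:
  "hdist A (restrict f A) g = hdist A f g" "hdist A f (restrict g A) = hdist A f g"
  unfolding hdist_def by (auto intro!: arg_cong[where f = card] arg_cong2[where f = "(/)"])

lemma hdist_code_le:
  assumes "finite C" "g \<in> C"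
  shows "hdist_code A f C \<le> hdist A f g"
  using assms by (simp add: hdist_code_def)

lemma hdist_code_attained:
  assumes "finite C" "C \<noteq> {}"
  obtains g where "g \<in> C" "hdist A f g = hdist_code A f C"
  proof -
  have "hdist_code A f C \<in> hdist A f ` C"
    unfolding hdist_code_def using assms by (intro Min_in) auto
  then show thesis
    using that by auto
qed

lemma hdist_code_triangle:
  assumes "finite A" "finite C" "C \<noteq> {}"
  shows "hdist_code A f C \<le> hdist A f g + hdist_code A g C"
proof -
  obtain c where c: "c \<in> C" "hdist A g c = hdist_code A g C"
    using hdist_code_attained[OF assms(2,3)] by metis
  have "hdist_code A f C \<le> hdist A f c"
    using assms c by (intro hdist_code_le)
  also have "\<dots> \<le> hdist A f g + hdist A g c"
    using assms by (intro hdist_triangle)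
  finally show ?thesis
    using c by simp
qed

lemma finite_code_on:
  assumes "finite A" "finite \<Sigma>"
  shows "finite (code_on \<Sigma> T B A)"
  by (rule finite_subset[of _ "A \<rightarrow>\<^sub>E \<Sigma>"]) (auto simp: code_on_def intro!: finite_PiE assms)

text \<open>Every base code inside \<open>A'\<close> also lies inside \<open>A\<close>, so its
  constraint is inherited. This passes codewords from \<open>V\<close> to \<open>s\<close> and from
  \<open>s\<close> to \<open>k\<close>.\<close>

lemma code_on_restrict:
  assumes "w \<in> code_on \<Sigma> T B A" "A' \<subseteq> A"
  shows "restrict w A' \<in> code_on \<Sigma> T B A'"
  using assms by (auto simp: code_on_def restrict_PiE_iff Int_absorb1 PiE_iff)

section \<open>The Markov property\<close>

text \<open>Since \<open>s\<close> is drawn from \<open>k\<close> alone, conditioning on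
  \<open>s\<close> besides \<open>k\<close> does not change the law of the vertex, which stays
  uniform in \<open>k\<close>.\<close>

lemma markov_vertex_given_sk:
  assumes "markov P"
    and unif: "\<And>k. k \<in> k_of ` set_pmf P \<Longrightarrow>
      map_pmf v_of (cond_pmf P {x. k_of x = k}) = pmf_of_set k"
  shows "map_pmf (\<lambda>x. ((s_of x, k_of x), v_of x)) P =
    bind_pmf (map_pmf (\<lambda>x. (s_of x, k_of x)) P) (\<lambda>y. map_pmf (Pair y) (pmf_of_set (snd y)))"
proof -
  obtain p0 p1 p2 p3 where P: "P = bind_pmf p0 (\<lambda>v. bind_pmf (p1 v) (\<lambda>t. bind_pmf (p2 t)
      (\<lambda>k. map_pmf (\<lambda>s. (v, t, k, s)) (p3 k))))"
    using assms(1) unfolding markov_def by blast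
  define Q where "Q = bind_pmf p0 (\<lambda>v. bind_pmf (p1 v) (\<lambda>t. map_pmf (\<lambda>k. (k, v)) (p2 t)))"
  define M where "M = map_pmf k_of P"
  have Q: "Q = map_pmf (\<lambda>x. (k_of x, v_of x)) P"
    unfolding P Q_def by (simp add: map_bind_pmf map_pmf_comp map_pmf_def[of "\<lambda>k. (k, _)"])
  have v_given_k: "cond_pmf Q {y. fst y = k} = map_pmf (Pair k) (pmf_of_set k)"
    if k: "k \<in> set_pmf M" for k
  proof -
    have ne: "set_pmf P \<inter> {x. k_of x = k} \<noteq> {}"
      using k by (auto simp: M_def)
    have "cond_pmf Q {y. fst y = k} = map_pmf (\<lambda>x. (k_of x, v_of x)) (cond_pmf P {x. k_of x = k})"
      unfolding Q using ne by (subst cond_map_pmf) (auto simp: vimage_def)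
    also have "\<dots> = map_pmf (\<lambda>x. (k, v_of x)) (cond_pmf P {x. k_of x = k})"
      using ne by (intro map_pmf_cong) auto
    also have "\<dots> = map_pmf (Pair k) (map_pmf v_of (cond_pmf P {x. k_of x = k}))"
      by (simp add: map_pmf_comp)
    finally show ?thesis
      using unif k by (simp add: M_def)
  qed
  have M: "M = map_pmf fst Q"
    by (simp add: M_def Q map_pmf_comp)
  have "Q = bind_pmf M (\<lambda>k. cond_pmf Q {y. fst y = k})"
    by (simp add: M bind_map_cond_pmf)
  also have "\<dots> = bind_pmf M (\<lambda>k. map_pmf (Pair k) (pmf_of_set k))"
    by (intro bind_pmf_cong v_given_k refl)
  finally have Q': "Q = bind_pmf M (\<lambda>k. map_pmf (Pair k) (pmf_of_set k))" .
  have sk: "map_pmf (\<lambda>x. (s_of x, k_of x)) P = bind_pmf M (\<lambda>k. map_pmf (\<lambda>s. (s, k)) (p3 k))"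
    unfolding M_def by (subst (1 2) P) (simp add: map_bind_pmf bind_map_pmf bind_assoc_pmf bind_return_pmf map_pmf_comp)
  \<comment> \<open>The kernel \<open>p3\<close> sees only \<open>k\<close>, so \<open>s\<close> can
    be drawn after the pair \<open>(k, v)\<close> with \<open>t\<close> already forgotten.\<close>
  have "map_pmf (\<lambda>x. ((s_of x, k_of x), v_of x)) P =
      bind_pmf Q (\<lambda>(k, v). map_pmf (\<lambda>s. ((s, k), v)) (p3 k))"
    unfolding Q_def
    by (subst P) (simp add: map_bind_pmf bind_map_pmf bind_assoc_pmf bind_return_pmf map_pmf_comp)
  also have "\<dots> = bind_pmf M (\<lambda>k. bind_pmf (pmf_of_set k) (\<lambda>v. map_pmf (\<lambda>s. ((s, k), v)) (p3 k)))"
    by (simp add: Q' bind_assoc_pmf bind_map_pmf)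
  \<comment> \<open>Given \<open>k\<close>, the draws of \<open>v\<close> and \<open>s\<close> are
    independent and may be swapped.\<close>
  also have "\<dots> = bind_pmf M (\<lambda>k. bind_pmf (p3 k) (\<lambda>s. map_pmf (\<lambda>v. ((s, k), v)) (pmf_of_set k)))"
    unfolding map_pmf_def by (subst bind_commute_pmf) simp
  also have "\<dots> = bind_pmf (map_pmf (\<lambda>x. (s_of x, k_of x)) P)
      (\<lambda>y. map_pmf (Pair y) (pmf_of_set (snd y)))"
    by (simp add: sk bind_assoc_pmf bind_map_pmf)
  finally show ?thesis .
qed

section \<open>The support of the chain\<close>

lemma prob_pmf_cong:
  assumes "\<And>x. x \<in> set_pmf p \<Longrightarrow> x \<in> A \<longleftrightarrow> x \<in> A'"
  shows "measure_pmf.prob p A = measure_pmf.prob p A'"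
  using assms by (intro measure_pmf.finite_measure_eq_AE AE_pmfI) auto

lemma prob_pmf_mono:
  assumes "\<And>x. x \<in> set_pmf p \<Longrightarrow> x \<in> A \<Longrightarrow> x \<in> A'"
  shows "measure_pmf.prob p A \<le> measure_pmf.prob p A'"
  using assms by (intro measure_pmf.finite_measure_mono_AE AE_pmfI) auto

lemma layered_chainD:
  assumes "layered_chain P V T K S" "x \<in> set_pmf P"
  shows "v_of x \<in> V" "t_of x \<in> T" "k_of x \<in> K" "s_of x \<in> S"
    "v_of x \<in> t_of x" "t_of x \<subseteq> k_of x" "k_of x \<subseteq> s_of x" "s_of x \<subseteq> V"
proof -
  obtain v t k s where x: "x = (v, t, k, s)"
    by (cases x)
  have "\<forall>(v, t, k, s) \<in> set_pmf P. v \<in> V \<and> t \<in> T \<and> k \<in> K \<and> s \<in> S \<and> v \<in> t \<and> t \<subseteq> k \<and> k \<subseteq> s"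
    and S: "S \<subseteq> Pow V"
    using assms(1) by (simp_all add: layered_chain_def)
  from bspec[OF this(1) assms(2)] S
  show "v_of x \<in> V" "t_of x \<in> T" "k_of x \<in> K" "s_of x \<in> S"
    "v_of x \<in> t_of x" "t_of x \<subseteq> k_of x" "k_of x \<subseteq> s_of x" "s_of x \<subseteq> V"
    by (auto simp: x)
qed

text \<open>A finite support makes every real function integrable, as monotonicity of expectations
  requires.\<close>

lemma layered_chain_finite:
  assumes "layered_chain P V T K S" "finite V"
  shows "finite (set_pmf P)"
proof (rule finite_subset)
  show "set_pmf P \<subseteq> V \<times> Pow V \<times> Pow V \<times> Pow V"
  proof
    fix x assume "x \<in> set_pmf P"
    from layered_chainD[OF assms(1) this] show "x \<in> V \<times> Pow V \<times> Pow V \<times> Pow V"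
      by (cases x) auto
  qed
qed (use assms(2) in auto)

lemma layer_images:
  assumes "layered_chain P V T K S"
  shows "v_of ` set_pmf P = V" "t_of ` set_pmf P = T" "k_of ` set_pmf P = K" "s_of ` set_pmf P = S"
  using assms by (simp_all add: layered_chain_def nondegenerate_def)

section \<open>Local correction\<close>

text \<open>Given \<open>s\<close>, the vertex is uniform in \<open>s\<close>, so the conditional
  disagreement probability is the distance from \<open>w\<close> on \<open>s\<close> to its nearest
  codeword. Local testability bounds it for each \<open>s\<close>, and averaging over
  \<open>s\<close> gives the claim.\<close>

lemma prob_local_correction:
  assumes chain: "layered_chain P V T K S" and fin: "finite V"
    and unif: "uniform_vertices P V K S"
    and lt: "\<And>s. s \<in> S \<Longrightarrow> locally_testable \<Sigma> B s (C s) (map_pmf t_of (cond_pmf P {x. s_of x = s})) \<rho>"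
    and w: "w \<in> V \<rightarrow>\<^sub>E \<Sigma>"
    and nearest: "\<And>s. s \<in> S \<Longrightarrow> hdist s (restrict w s) (f s) = hdist_code s (restrict w s) (C s)"
  shows "\<rho> * measure_pmf.prob P {x. f (s_of x) (v_of x) \<noteq> w (v_of x)}
    \<le> measure_pmf.prob P {x. restrict w (t_of x) \<notin> B (t_of x)}"
proof -
  let ?c = "\<lambda>z. cond_pmf P {x. s_of x = s_of z}"
  have pointwise: "\<rho> * measure_pmf.prob (?c z) {x. f (s_of x) (v_of x) \<noteq> w (v_of x)}
      \<le> measure_pmf.prob (?c z) {x. restrict w (t_of x) \<notin> B (t_of x)}"
    if z: "z \<in> set_pmf P" for z
  proof -
    define s where "s = s_of z"
    have s: "s \<in> S" "s \<subseteq> V" "s \<noteq> {}"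
      using layered_chainD[OF chain z] by (auto simp: s_def)
    have ne: "set_pmf P \<inter> {x. s_of x = s} \<noteq> {}"
      using z by (auto simp: s_def)
    have "measure_pmf.prob (cond_pmf P {x. s_of x = s}) {x. f (s_of x) (v_of x) \<noteq> w (v_of x)}
        = measure_pmf.prob (cond_pmf P {x. s_of x = s}) {x. f s (v_of x) \<noteq> w (v_of x)}"
      using ne by (intro prob_pmf_cong) auto
    also have "\<dots> = measure_pmf.prob (map_pmf v_of (cond_pmf P {x. s_of x = s})) {v. f s v \<noteq> w v}"
      by (simp add: vimage_def)
    also have "\<dots> = hdist s (f s) w"
      using unif s finite_subset[OF _ fin]
      by (simp add: uniform_vertices_def prob_pmf_of_set_eq_hdist)
    also have "\<dots> = hdist_code s (restrict w s) (C s)"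
      using nearest[OF s(1)] by (simp add: hdist_restrict hdist_commute[of s "f s"])
    finally have 1: "measure_pmf.prob (cond_pmf P {x. s_of x = s}) {x. f (s_of x) (v_of x) \<noteq> w (v_of x)}
      = hdist_code s (restrict w s) (C s)" .
    have ws: "restrict w s \<in> s \<rightarrow>\<^sub>E \<Sigma>"
      using w s by (auto simp: PiE_iff)
    have "\<rho> * hdist_code s (restrict w s) (C s) \<le>
        measure_pmf.prob (map_pmf t_of (cond_pmf P {x. s_of x = s})) {t. restrict (restrict w s) t \<notin> B t}"
      using lt[OF s(1)] ws unfolding locally_testable_def by blast
    also have "\<dots> = measure_pmf.prob (cond_pmf P {x. s_of x = s})
        {x. restrict (restrict w s) (t_of x) \<notin> B (t_of x)}"
      by (simp add: vimage_def)
    also have "\<dots> = measure_pmf.prob (cond_pmf P {x. s_of x = s}) {x. restrict w (t_of x) \<notin> B (t_of x)}"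
    proof (rule prob_pmf_cong)
      fix x assume "x \<in> set_pmf (cond_pmf P {x. s_of x = s})"
      then have "x \<in> set_pmf P" "s_of x = s"
        using ne by auto
      then have "t_of x \<subseteq> s"
        using layered_chainD(6,7)[OF chain] by blast
      then show "x \<in> {x. restrict (restrict w s) (t_of x) \<notin> B (t_of x)} \<longleftrightarrow>
          x \<in> {x. restrict w (t_of x) \<notin> B (t_of x)}"
        by (simp add: Int_absorb1)
    qed
    finally show ?thesis
      by (simp add: 1 flip: s_def)
  qed
  have int: "integrable (measure_pmf P) g" for g :: "_ \<Rightarrow> real"
    by (rule integrable_measure_pmf_finite[OF layered_chain_finite[OF chain fin]])
  have "\<rho> * measure_pmf.prob P {x. f (s_of x) (v_of x) \<noteq> w (v_of x)} =
      measure_pmf.expectation P (\<lambda>z. \<rho> * measure_pmf.prob (?c z) {x. f (s_of x) (v_of x) \<noteq> w (v_of x)})"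
    by (subst prob_conditioned[of P _ s_of]) simp
  also have "\<dots> \<le> measure_pmf.expectation P
      (\<lambda>z. measure_pmf.prob (?c z) {x. restrict w (t_of x) \<notin> B (t_of x)})"
    using pointwise by (intro integral_mono_AE int AE_pmfI)
  also have "\<dots> = measure_pmf.prob P {x. restrict w (t_of x) \<notin> B (t_of x)}"
    by (rule prob_conditioned[symmetric])
  finally show ?thesis .
qed

section \<open>Disagreement on the edges of the agreement graph\<close>

text \<open>
  The expected distance of \<open>f s\<close> to \<open>w\<close> inside \<open>k\<close> equals the one inside \<open>s\<close> because the vertex is
  uniform in \<open>k\<close> even given \<open>s\<close>. The factor \<open>2\<close> counts the endpoints of an edge: if they disagree on
  \<open>k\<close>, then \<open>w\<close> cannot be close to both.
\<close>

lemma disagreement_bound: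
  assumes chain: "layered_chain P V T K S" and fin: "finite V"
    and unif: "uniform_vertices P V K S"
    and graph: "agreement_graph P K S E W"
    and ens: "delta_ensemble \<Sigma> S E \<delta> f"
  shows "\<delta> * (1 - agreement_value W f)
    \<le> 2 * measure_pmf.prob P {x. f (s_of x) (v_of x) \<noteq> w (v_of x)}"
proof -
  let ?\<phi> = "\<lambda>(s, k). hdist k (f s) w"
  have sub: "T \<subseteq> Pow V" "K \<subseteq> Pow V" "S \<subseteq> Pow V"
    using chain by (simp_all add: layered_chain_def)
  have edge: "\<exists>s\<in>S. \<exists>s'\<in>S. e = {s, s'} \<and> k \<in> K \<and> k \<subseteq> s \<inter> s'" if "(e, k) \<in> E" for e k
    using bspec[OF conjunct1[OF graph[unfolded agreement_graph_def]] that] by simp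
  have WE: "set_pmf W \<subseteq> E"
    and Wmarg: "bind_pmf W (\<lambda>(e, k). map_pmf (\<lambda>s. (s, k)) (pmf_of_set e)) =
      map_pmf (\<lambda>x. (s_of x, k_of x)) P"
    using graph by (simp_all add: agreement_graph_def)
  have "set_pmf W \<subseteq> Pow (Pow V) \<times> Pow V"
  proof
    fix y assume "y \<in> set_pmf W"
    with WE have "(fst y, snd y) \<in> E"
      by auto
    from edge[OF this] obtain s s' where y: "s \<in> S" "s' \<in> S" "fst y = {s, s'}" "snd y \<in> K"
      by metis
    have "s \<in> Pow V" "s' \<in> Pow V" "snd y \<in> Pow V"
      using y subsetD[OF sub(3)] subsetD[OF sub(2)] by metis+
    then show "y \<in> Pow (Pow V) \<times> Pow V"
      by (simp add: mem_Times_iff y(3))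
  qed
  then have finW: "finite (set_pmf W)"
    by (rule finite_subset) (use fin in auto)
  have int: "integrable (measure_pmf W) g" for g :: "_ \<Rightarrow> real"
    by (rule integrable_measure_pmf_finite[OF finW])
  have pointwise: "\<delta> * indicator {y. \<not> agrees f y} y \<le>
      2 * measure_pmf.expectation (case y of (e, k) \<Rightarrow> map_pmf (\<lambda>s. (s, k)) (pmf_of_set e)) ?\<phi>"
    if y: "y \<in> set_pmf W" for y
  proof -
    obtain e k where ek: "y = (e, k)"
      by (cases y)
    with y WE have E: "(e, k) \<in> E"
      by auto
    from edge[OF E] obtain s s' where ss': "s \<in> S" "s' \<in> S" "e = {s, s'}" "k \<in> K" "k \<subseteq> s \<inter> s'"
      by metis
    have mean: "measure_pmf.expectation (map_pmf (\<lambda>s. (s, k)) (pmf_of_set e)) ?\<phi> =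
        (\<Sum>s\<in>e. hdist k (f s) w) / card e"
      using ss'(3) by (simp add: integral_pmf_of_set)
    show ?thesis
    proof (cases "agrees f y")
      case True
      have "0 \<le> (\<Sum>s\<in>e. hdist k (f s) w) / card e"
        by (intro divide_nonneg_nonneg sum_nonneg hdist_nonneg) simp
      with True show ?thesis
        using mean by (simp add: ek)
    next
      case False
      then have ne: "restrict (f s) k \<noteq> restrict (f s') k"
        using ss'(3) by (auto simp: agrees_def ek)
      \<comment> \<open>A loop always agrees, so here \<open>e\<close> has two elements and its mean
        distance is half the sum over both endpoints.\<close>
      then have "s \<noteq> s'" "k \<noteq> {}"
        by auto
      have k: "finite k"
        using subsetD[OF sub(2) ss'(4)] finite_subset[OF _ fin] by simp
      have "\<forall>s s'. e = {s, s'} \<longrightarrow> restrict (f s) k = restrict (f s') k \<or>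
          \<delta> * real (card k) \<le> real (card {x \<in> k. f s x \<noteq> f s' x})"
        using bspec[OF conjunct2[OF ens[unfolded delta_ensemble_def]] E] by simp
      with ss'(3) ne have "\<delta> * real (card k) \<le> real (card {x \<in> k. f s x \<noteq> f s' x})"
        by metis
      then have "\<delta> \<le> hdist k (f s) (f s')"
        using k \<open>k \<noteq> {}\<close> by (simp add: hdist_def pos_le_divide_eq card_gt_0_iff)
      also have "\<dots> \<le> hdist k (f s) w + hdist k w (f s')"
        by (rule hdist_triangle[OF k])
      also have "\<dots> = 2 * ((\<Sum>s\<in>e. hdist k (f s) w) / card e)"
        using \<open>s \<noteq> s'\<close> by (simp add: ss'(3) hdist_commute[of k w])
      finally show ?thesis
        using False mean by (simp add: ek)
    qed
  qed
  have "\<delta> * (1 - agreement_value W f) = \<delta> * measure_pmf.prob W {y. \<not> agrees f y}"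
    using measure_pmf.prob_compl[of "{y. agrees f y}" W]
    by (simp add: agreement_value_def Compl_eq_Diff_UNIV[symmetric] Collect_neg_eq)
  also have "\<dots> = measure_pmf.expectation W (\<lambda>y. \<delta> * indicator {y. \<not> agrees f y} y)"
    by simp
  also have "\<dots> \<le> measure_pmf.expectation W (\<lambda>y. 2 * measure_pmf.expectation
      (case y of (e, k) \<Rightarrow> map_pmf (\<lambda>s. (s, k)) (pmf_of_set e)) ?\<phi>)"
    using pointwise by (intro integral_mono_AE int AE_pmfI)
  \<comment> \<open>A random endpoint of a random edge has the law of \<open>(s, k)\<close> in the
    chain, which moves the average from the graph to the chain.\<close>
  also have "\<dots> = 2 * measure_pmf.expectation (map_pmf (\<lambda>x. (s_of x, k_of x)) P) ?\<phi>"
    unfolding Wmarg[symmetric]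
    by (subst integral_bind_pmf_bounded[where b = 1])
       (auto simp: split_beta abs_le_iff hdist_le_1 intro: order_trans[OF _ hdist_nonneg])
  \<comment> \<open>The distance inside \<open>k\<close> is the probability that a uniform vertex of
    \<open>k\<close> separates \<open>f s\<close> from \<open>w\<close>. Each such \<open>k\<close>
    is nonempty, as it contains the vertex of a chain sample.\<close>
  also have "measure_pmf.expectation (map_pmf (\<lambda>x. (s_of x, k_of x)) P) ?\<phi> =
      measure_pmf.expectation (map_pmf (\<lambda>x. (s_of x, k_of x)) P)
        (\<lambda>y. measure_pmf.prob (map_pmf (Pair y) (pmf_of_set (snd y))) {((s, k), v). f s v \<noteq> w v})"
  proof (intro integral_cong_AE AE_pmfI)
    fix y assume "y \<in> set_pmf (map_pmf (\<lambda>x. (s_of x, k_of x)) P)"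
    then obtain x where x: "x \<in> set_pmf P" "y = (s_of x, k_of x)"
      by auto
    have "k_of x \<noteq> {}" "finite (k_of x)"
      using layered_chainD[OF chain x(1)] finite_subset[OF _ fin] by blast+
    then show "?\<phi> y = measure_pmf.prob (map_pmf (Pair y) (pmf_of_set (snd y))) {((s, k), v). f s v \<noteq> w v}"
      by (simp add: x vimage_def prob_pmf_of_set_eq_hdist)
  qed auto
  also have "\<dots> = measure_pmf.prob (map_pmf (\<lambda>x. ((s_of x, k_of x), v_of x)) P) {((s, k), v). f s v \<noteq> w v}"
  proof (subst markov_vertex_given_sk)
    show "markov P"
      using chain by (simp add: layered_chain_def)
    show "map_pmf v_of (cond_pmf P {x. k_of x = k}) = pmf_of_set k" if "k \<in> k_of ` set_pmf P" for k
      using unif that layer_images(3)[OF chain] by (simp add: uniform_vertices_def)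
  qed (simp add: prob_bind_pmf)
  also have "\<dots> = measure_pmf.prob P {x. f (s_of x) (v_of x) \<noteq> w (v_of x)}"
    by (simp add: vimage_def)
  finally show ?thesis .
qed

section \<open>Amplification by the sampler\<close>

text \<open>A violated \<open>t\<close> makes every \<open>k\<close> above it bad, so the
  conditional probability of a bad \<open>k\<close> is 1, which exceeds the overall one by more than
  1/2. The sampler bound with \<eta> = 1/2 then yields the factor
  \<open>l / (1/2)^2 = 4 * l\<close>.\<close>

lemma sampler_amplification:
  assumes chain: "layered_chain P V T K S"
    and sampler: "is_sampler (map_pmf (\<lambda>x. (t_of x, k_of x)) P) T K l"
    and small: "measure_pmf.prob P {x. restrict G (k_of x) \<notin> code_on \<Sigma> T B (k_of x)} < 1 / 2"
      (is "?\<beta> < _")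
  shows "measure_pmf.prob P {x. restrict G (t_of x) \<notin> B (t_of x)}
    \<le> 4 * l * measure_pmf.prob P {x. restrict G (k_of x) \<notin> code_on \<Sigma> T B (k_of x)}"
proof -
  define Q where "Q = map_pmf (\<lambda>x. (t_of x, k_of x)) P"
  define A where "A = {k \<in> K. restrict G k \<notin> code_on \<Sigma> T B k}"
  define N where "N = {t \<in> T. measure_pmf.prob (map_pmf snd (cond_pmf Q {y. fst y = t})) A
    > measure_pmf.prob (map_pmf snd Q) A + 1 / 2}"
  have A: "measure_pmf.prob (map_pmf snd Q) A = ?\<beta>"
    unfolding Q_def map_pmf_comp measure_map_pmf
    using layered_chainD(3)[OF chain] by (intro prob_pmf_cong) (auto simp: A_def)
  have bad: "t_of x \<in> N" if x: "x \<in> set_pmf P" and viol: "restrict G (t_of x) \<notin> B (t_of x)" for x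
  proof -
    have ne: "set_pmf Q \<inter> {y. fst y = t_of x} \<noteq> {}"
      using x by (auto simp: Q_def)
    have "measure_pmf.prob (map_pmf snd (cond_pmf Q {y. fst y = t_of x})) A = 1"
    proof (subst measure_pmf.prob_eq_1)
      show "AE k in map_pmf snd (cond_pmf Q {y. fst y = t_of x}). k \<in> A"
      proof (rule AE_pmfI)
        fix k assume "k \<in> set_pmf (map_pmf snd (cond_pmf Q {y. fst y = t_of x}))"
        then have "(t_of x, k) \<in> set_pmf Q"
          using ne by auto
        then have "(t_of x, k) \<in> (\<lambda>z. (t_of z, k_of z)) ` set_pmf P"
          by (simp add: Q_def)
        then obtain z where "(t_of x, k) = (t_of z, k_of z)" "z \<in> set_pmf P"
          by (rule imageE)
        then have z: "z \<in> set_pmf P" "t_of z = t_of x" "k_of z = k"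
          by simp_all
        have k: "k \<in> K" "t_of x \<subseteq> k" "t_of x \<in> T"
          using layered_chainD[OF chain z(1)] z by auto
        then have "restrict (restrict G k) (t_of x) \<notin> B (t_of x)"
          using viol by (simp add: Int_absorb1)
        with k show "k \<in> A"
          by (auto simp: A_def code_on_def)
      qed
    qed simp
    \<comment> \<open>The hypothesis \<open>small\<close> enters here: 1 is larger than the
      probability of \<open>A\<close> plus 1/2.\<close>
    then show ?thesis
      using layered_chainD(2)[OF chain x] small by (simp add: N_def A del: measure_map_pmf)
  qed
  have "measure_pmf.prob P {x. restrict G (t_of x) \<notin> B (t_of x)} \<le> measure_pmf.prob (map_pmf fst Q) N"
    unfolding Q_def map_pmf_comp measure_map_pmf using bad by (intro prob_pmf_mono) auto
  also have "\<dots> \<le> l / (1 / 2)\<^sup>2 * measure_pmf.prob (map_pmf snd Q) A"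
    using sampler[unfolded is_sampler_def Let_def, rule_format, of A "1 / 2"]
    unfolding N_def Q_def by (simp add: A_def)
  also have "\<dots> = 4 * l * ?\<beta>"
    by (simp only: A) (simp add: power2_eq_square)
  finally show ?thesis .
qed

section \<open>Correcting a word through agreement\<close>

text \<open>Both endpoints of an edge restrict to codewords on \<open>k\<close>, and distinct
  codewords there are \<delta>-far apart.\<close>

lemma codeword_ensemble:
  assumes graph: "agreement_graph P K S E W"
    and codewords: "\<And>s. s \<in> S \<Longrightarrow> f s \<in> code_on \<Sigma> T B s"
    and distance: "\<And>k. k \<in> K \<Longrightarrow> rel_distance_at_least k (code_on \<Sigma> T B k) \<delta>"
  shows "delta_ensemble \<Sigma> S E \<delta> f"
proof -
  have pair: "restrict (f s) k = restrict (f s') k \<or>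
      \<delta> * real (card k) \<le> real (card {x \<in> k. f s x \<noteq> f s' x})"
    if E: "(e, k) \<in> E" and e: "e = {s, s'}" for e k s s'
  proof -
    have "\<exists>s\<in>S. \<exists>s'\<in>S. e = {s, s'} \<and> k \<in> K \<and> k \<subseteq> s \<inter> s'"
      using bspec[OF conjunct1[OF graph[unfolded agreement_graph_def]] E] by simp
    \<comment> \<open>The graph names some endpoints \<open>r\<close>, \<open>r'\<close> of the
      unordered edge, not necessarily in the order \<open>s\<close>, \<open>s'\<close>; facts are
      therefore transferred through membership in \<open>e\<close>.\<close>
    then obtain r r' where r: "r \<in> S" "r' \<in> S" "e = {r, r'}" "k \<in> K" "k \<subseteq> r" "k \<subseteq> r'"
      by (metis le_inf_iff)
    have in_S: "u \<in> S" "k \<subseteq> u" if "u \<in> e" for u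
      using that r by auto
    have code: "restrict (f u) k \<in> code_on \<Sigma> T B k" if "u \<in> e" for u
      by (rule code_on_restrict[OF codewords[OF in_S(1)[OF that]] in_S(2)[OF that]])
    have mem: "s \<in> e" "s' \<in> e"
      using e by simp_all
    show ?thesis
    proof (cases "restrict (f s) k = restrict (f s') k")
      case False
      with distance[OF r(4)] code[OF mem(1)] code[OF mem(2)] have "\<delta> \<le> hdist k (f s) (f s')"
        unfolding rel_distance_at_least_def by (metis hdist_restrict)
      then show ?thesis
        \<comment> \<open>For \<open>card k = 0\<close> the left-hand side of the bound is 0,
          whereas the quotient in \<open>hdist\<close> has no content.\<close>
        by (cases "card k = 0") (simp_all add: hdist_def pos_le_divide_eq)
    qed simp
  qed
  show ?thesis
    unfolding delta_ensemble_def ensemble_def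
  proof (intro conjI ballI)
    show "f s \<in> s \<rightarrow>\<^sub>E \<Sigma>" if "s \<in> S" for s
      using codewords[OF that] by (simp add: code_on_def)
    fix y assume "y \<in> E"
    then have "(fst y, snd y) \<in> E"
      by simp
    then show "case y of (e, k) \<Rightarrow> \<forall>s s'. e = {s, s'} \<longrightarrow> restrict (f s) k = restrict (f s') k \<or>
        \<delta> * real (card k) \<le> real (card {x \<in> k. f s x \<noteq> f s' x})"
      unfolding split_beta by (intro allI impI pair[of "fst y"])
  qed
qed

text \<open>One round of correction: \<open>G\<close> stays close to \<open>w\<close> and violates
  at most an eighth as much, which is what a minimality argument needs.\<close>

lemma correction_step:
  fixes V :: "'v set" and \<Sigma> :: "'a set"
  assumes fin: "finite V" "finite \<Sigma>"
    and pos: "0 < \<rho>" "0 < \<delta>" "0 < \<alpha>" and le: "\<delta> \<le> 1" "\<alpha> \<le> 2"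
    and l: "l \<le> \<rho> * \<delta> * \<alpha> / 64"
    and MAS: "is_MAS P V T K S \<Sigma> l \<delta> \<alpha>"
    and unif: "uniform_vertices P V K S"
    and nonempty: "code_on \<Sigma> T B V \<noteq> {}"
    and distance: "\<And>k. k \<in> K \<Longrightarrow> rel_distance_at_least k (code_on \<Sigma> T B k) \<delta>"
    and lt: "\<And>s. s \<in> S \<Longrightarrow> locally_testable \<Sigma> B s (code_on \<Sigma> T B s)
      (map_pmf t_of (cond_pmf P {x. s_of x = s})) \<rho>"
    and w: "w \<in> V \<rightarrow>\<^sub>E \<Sigma>"
    and few: "measure_pmf.prob P {x. restrict w (t_of x) \<notin> B (t_of x)} < \<rho> * \<delta> * \<alpha> / 4"
      (is "?\<epsilon> < _")
  obtains G where "G \<in> V \<rightarrow>\<^sub>E \<Sigma>"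
    "\<rho> * \<delta> * \<alpha> * hdist V w G \<le> 4 * measure_pmf.prob P {x. restrict w (t_of x) \<notin> B (t_of x)}"
    "8 * measure_pmf.prob P {x. restrict G (t_of x) \<notin> B (t_of x)}
      \<le> measure_pmf.prob P {x. restrict w (t_of x) \<notin> B (t_of x)}"
proof -
  from MAS obtain E W where chain: "layered_chain P V T K S"
    and graph: "agreement_graph P K S E W"
    and sound: "sound_for_delta_ensembles P V S E W \<Sigma> \<delta> \<alpha>"
    and sampler: "is_sampler (map_pmf (\<lambda>x. (t_of x, k_of x)) P) T K l"
    unfolding is_MAS_def by metis
  have SV: "S \<subseteq> Pow V"
    using chain by (simp add: layered_chain_def)
  have "\<exists>g. g \<in> code_on \<Sigma> T B s \<and>
      hdist s (restrict w s) g = hdist_code s (restrict w s) (code_on \<Sigma> T B s)" if "s \<in> S" for s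
  proof -
    have s: "s \<subseteq> V"
      using subsetD[OF SV that] by simp
    \<comment> \<open>A global codeword restricts to one on \<open>s\<close>, so the minimum
      distance to the local code is attained.\<close>
    obtain c where "c \<in> code_on \<Sigma> T B V"
      using nonempty by auto
    then have "code_on \<Sigma> T B s \<noteq> {}"
      using code_on_restrict[OF _ s] by blast
    then show ?thesis
      using hdist_code_attained[OF finite_code_on[OF finite_subset[OF s fin(1)] fin(2)]] by metis
  qed
  then obtain f where f: "\<And>s. s \<in> S \<Longrightarrow> f s \<in> code_on \<Sigma> T B s"
    "\<And>s. s \<in> S \<Longrightarrow> hdist s (restrict w s) (f s) = hdist_code s (restrict w s) (code_on \<Sigma> T B s)"
    by metis
  define d where "d = measure_pmf.prob P {x. f (s_of x) (v_of x) \<noteq> w (v_of x)}"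
  have d: "\<rho> * d \<le> ?\<epsilon>"
    unfolding d_def by (rule prob_local_correction[OF chain fin(1) unif lt w f(2)])
  have ens: "delta_ensemble \<Sigma> S E \<delta> f"
    by (rule codeword_ensemble[OF graph f(1) distance])
  have disagree: "\<delta> * (1 - agreement_value W f) \<le> 2 * d"
    unfolding d_def by (rule disagreement_bound[OF chain fin(1) unif graph ens])
  define err where "err = (\<lambda>G. measure_pmf.prob P
    {x. restrict (f (s_of x)) (k_of x) \<noteq> restrict G (k_of x)})"
  have "Min (err ` (V \<rightarrow>\<^sub>E \<Sigma>)) \<in> err ` (V \<rightarrow>\<^sub>E \<Sigma>)"
    using w fin by (intro Min_in finite_imageI finite_PiE) auto
  then obtain G where G: "Min (err ` (V \<rightarrow>\<^sub>E \<Sigma>)) = err G" "G \<in> V \<rightarrow>\<^sub>E \<Sigma>"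
    by (rule imageE)
  have "\<alpha> * err G \<le> 1 - agreement_value W f"
    using sound[unfolded sound_for_delta_ensembles_def, rule_format, OF ens] G(1)
    by (simp add: err_def)
  then have "\<delta> * (\<alpha> * err G) \<le> \<delta> * (1 - agreement_value W f)"
    using pos by (intro mult_left_mono) auto
  with disagree have "\<delta> * (\<alpha> * err G) \<le> 2 * d"
    by simp
  then have "\<rho> * (\<delta> * (\<alpha> * err G)) \<le> \<rho> * (2 * d)"
    using pos by (intro mult_left_mono) auto
  with d have err: "\<rho> * \<delta> * \<alpha> * err G \<le> 2 * ?\<epsilon>"
    by (simp add: mult.assoc)

  have "hdist V w G = measure_pmf.prob (map_pmf v_of P) {v. w v \<noteq> G v}"
  proof -
    have "V \<noteq> {}"
      using layer_images(1)[OF chain] set_pmf_not_empty[of P] by auto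
    then show ?thesis
      using unif fin by (simp add: uniform_vertices_def prob_pmf_of_set_eq_hdist del: measure_map_pmf)
  qed
  also have "\<dots> = measure_pmf.prob P {x. w (v_of x) \<noteq> G (v_of x)}"
    by (simp add: vimage_def)
  \<comment> \<open>The vertex lies in \<open>k\<close>: if \<open>w\<close> and \<open>G\<close>
    differ there, then \<open>f s\<close> differs from \<open>w\<close> at that vertex or from
    \<open>G\<close> on \<open>k\<close>.\<close>
  also have "\<dots> \<le> measure_pmf.prob P ({x. f (s_of x) (v_of x) \<noteq> w (v_of x)} \<union>
      {x. restrict (f (s_of x)) (k_of x) \<noteq> restrict G (k_of x)})"
  proof (rule prob_pmf_mono)
    fix x assume x: "x \<in> set_pmf P" and ne: "x \<in> {x. w (v_of x) \<noteq> G (v_of x)}"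
    have "v_of x \<in> k_of x"
      using layered_chainD(5,6)[OF chain x] by auto
    then show "x \<in> {x. f (s_of x) (v_of x) \<noteq> w (v_of x)} \<union>
        {x. restrict (f (s_of x)) (k_of x) \<noteq> restrict G (k_of x)}"
      using ne by simp (metis restrict_apply)
  qed
  also have "\<dots> \<le> d + err G"
    unfolding d_def err_def by (rule measure_Un_le) auto
  finally have "\<rho> * \<delta> * \<alpha> * hdist V w G \<le> \<rho> * \<delta> * \<alpha> * (d + err G)"
    using pos by (intro mult_left_mono) auto
  also have "\<dots> = \<delta> * \<alpha> * (\<rho> * d) + \<rho> * \<delta> * \<alpha> * err G"
    by (simp add: algebra_simps)
  \<comment> \<open>The bounds \<delta> \<le> 1 and \<alpha> \<le> 2 enter here. The other summand
    is also at most \<open>2 * ?\<epsilon>\<close>, hence the 4 in \<open>close\<close>.\<close>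
  also have "\<delta> * \<alpha> * (\<rho> * d) \<le> 2 * ?\<epsilon>"
  proof (rule mult_mono[OF _ d])
    show "\<delta> * \<alpha> \<le> 2"
      using mult_mono[of \<delta> 1 \<alpha> 2] pos le by simp
    show "0 \<le> \<rho> * d"
      using pos by (simp add: d_def)
  qed simp
  finally have close: "\<rho> * \<delta> * \<alpha> * hdist V w G \<le> 4 * ?\<epsilon>"
    using err by simp

  define \<beta> where "\<beta> = measure_pmf.prob P {x. restrict G (k_of x) \<notin> code_on \<Sigma> T B (k_of x)}"
  \<comment> \<open>On \<open>k\<close> the word \<open>f s\<close> is a codeword, so
    \<open>G\<close> can fail to be one only where the two disagree.\<close>
  have "\<beta> \<le> err G"
    unfolding \<beta>_def err_def
  proof (rule prob_pmf_mono)
    fix x assume x: "x \<in> set_pmf P" and bad: "x \<in> {x. restrict G (k_of x) \<notin> code_on \<Sigma> T B (k_of x)}"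
    have "restrict (f (s_of x)) (k_of x) \<in> code_on \<Sigma> T B (k_of x)"
      using layered_chainD(4,7)[OF chain x] by (intro code_on_restrict[OF f(1)])
    then show "x \<in> {x. restrict (f (s_of x)) (k_of x) \<noteq> restrict G (k_of x)}"
      using bad by auto
  qed
  then have "\<rho> * \<delta> * \<alpha> * \<beta> \<le> \<rho> * \<delta> * \<alpha> * err G"
    using pos by (intro mult_left_mono) auto
  with err have \<beta>: "\<rho> * \<delta> * \<alpha> * \<beta> \<le> 2 * ?\<epsilon>"
    by simp
  \<comment> \<open>The threshold 1/4 in \<open>few\<close> is chosen to give the 1/2 that the
    sampler argument needs.\<close>
  then have "\<rho> * \<delta> * \<alpha> * \<beta> < \<rho> * \<delta> * \<alpha> * (1 / 2)"
    using few by simp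
  then have small: "\<beta> < 1 / 2"
    using pos by (subst (asm) mult_less_cancel_left_pos) auto
  have "measure_pmf.prob P {x. restrict G (t_of x) \<notin> B (t_of x)} \<le> 4 * l * \<beta>"
    using sampler_amplification[OF chain sampler] small unfolding \<beta>_def by blast
  also have "\<dots> \<le> 4 * (\<rho> * \<delta> * \<alpha> / 64) * \<beta>"
    using l by (intro mult_right_mono mult_left_mono) (auto simp: \<beta>_def)
  also have "\<dots> = \<rho> * \<delta> * \<alpha> * \<beta> / 16"
    by simp
  finally have "8 * measure_pmf.prob P {x. restrict G (t_of x) \<notin> B (t_of x)} \<le> ?\<epsilon>"
    using \<beta> by linarith
  with close G(2) show thesis
    by (intro that)
qed

section \<open>The minimal counterexample\<close>

theorem mainTheorem1:
  fixes V :: "'v set" and \<Sigma> :: "'a set"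
    and T K S :: "'v set set"
    and P :: "'v chain"
    and B :: "'v set \<Rightarrow> ('v \<Rightarrow> 'a) set"
    and \<rho> \<delta> l \<alpha> :: real
  assumes "finite V" and "finite \<Sigma>"
    and "0 \<le> \<rho>" and "0 \<le> \<delta>" and "0 \<le> l" and "0 \<le> \<alpha>"
    and "\<delta> \<le> 1" and "\<alpha> \<le> 2"
    and "l \<le> \<rho> * \<delta> * \<alpha> / 64"
    and "is_MAS P V T K S \<Sigma> l \<delta> \<alpha>"
    and "uniform_vertices P V K S"
    and "\<And>t. t \<in> T \<Longrightarrow> B t \<subseteq> t \<rightarrow>\<^sub>E \<Sigma>"
    and "code_on \<Sigma> T B V \<noteq> {}"
    and local_distance:
      "\<And>k. k \<in> K \<Longrightarrow> rel_distance_at_least k (code_on \<Sigma> T B k) \<delta>"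
    and local_local_testability:
      "\<And>s. s \<in> S \<Longrightarrow>
         locally_testable \<Sigma> B s (code_on \<Sigma> T B s)
           (map_pmf t_of (cond_pmf P {x. s_of x = s})) \<rho>"
  shows "locally_testable \<Sigma> B V (code_on \<Sigma> T B V) (map_pmf t_of P) (\<rho> * \<delta> * \<alpha> / 16)"
proof (cases "0 < \<rho> \<and> 0 < \<delta> \<and> 0 < \<alpha>")
  \<comment> \<open>With a vanishing factor the testability constant is 0 and the bound is
    nonnegativity of a probability.\<close>
  case False
  then have "\<rho> * \<delta> * \<alpha> = 0"
    using assms(3,4,6) by auto
  then show ?thesis
    by (auto simp: locally_testable_def)
next
  case True
  then have pos: "0 < \<rho>" "0 < \<delta>" "0 < \<alpha>"
    by auto
  let ?C = "code_on \<Sigma> T B V" and ?c = "\<rho> * \<delta> * \<alpha>"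
  define viol where "viol = (\<lambda>w. measure_pmf.prob P {x. restrict w (t_of x) \<notin> B (t_of x)})"
  have chain: "layered_chain P V T K S"
    using assms(10) by (simp add: is_MAS_def)
  have finC: "finite ?C"
    by (intro finite_code_on assms(1,2))
  have bound: "?c * hdist_code V w ?C \<le> 16 * viol w" if "w \<in> V \<rightarrow>\<^sub>E \<Sigma>" for w
  proof (rule ccontr)
    assume w_bad: "\<not> ?c * hdist_code V w ?C \<le> 16 * viol w"
    \<comment> \<open>There are finitely many words, so some counterexample has the least
      violation.\<close>
    define Bad where "Bad = {w \<in> V \<rightarrow>\<^sub>E \<Sigma>. \<not> ?c * hdist_code V w ?C \<le> 16 * viol w}"
    have "finite Bad"
      unfolding Bad_def using assms(1,2) by (intro finite_Collect_conjI disjI1) (auto intro: finite_PiE)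
    moreover have "Bad \<noteq> {}"
      using that w_bad by (auto simp: Bad_def)
    ultimately obtain u where u: "u \<in> Bad" "\<And>u'. u' \<in> Bad \<Longrightarrow> viol u \<le> viol u'"
      using ex_min_if_finite[of "viol ` Bad"] by (metis (no_types, lifting) arg_min_least arg_min_if_finite(1))
    then have uV: "u \<in> V \<rightarrow>\<^sub>E \<Sigma>" and u_bad: "16 * viol u < ?c * hdist_code V u ?C"
      by (auto simp: Bad_def)
    \<comment> \<open>By non-degeneracy every \<open>t\<close> in \<open>T\<close> has positive
      probability, so a word without violations is a codeword, at distance 0 from the code.\<close>
    have "viol u \<noteq> 0"
    proof
      assume "viol u = 0"
      then have "restrict u (t_of x) \<in> B (t_of x)" if "x \<in> set_pmf P" for x
        using that measure_pmf_posI[of x P "{x. restrict u (t_of x) \<notin> B (t_of x)}"]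
        by (auto simp: viol_def)
      then have "u \<in> ?C"
        using uV layer_images(2)[OF chain] by (auto simp: code_on_def)
      then have "hdist_code V u ?C \<le> 0"
        using hdist_code_le[OF finC, of u V u] by (simp add: hdist_def)
      then have "?c * hdist_code V u ?C \<le> 0"
        using pos by (simp add: mult_le_0_iff)
      with u_bad \<open>viol u = 0\<close> show False
        by simp
    qed
    then have viol_pos: "0 < viol u"
      by (simp add: viol_def zero_less_measure_iff)
    have "hdist_code V u ?C \<le> 1"
    proof -
      obtain g where "g \<in> ?C"
        using assms(13) by auto
      then show ?thesis
        using hdist_code_le[OF finC, of g V u] hdist_le_1[of V u g] by simp
    qed
    then have "?c * hdist_code V u ?C \<le> ?c"
      using mult_left_mono[of "hdist_code V u ?C" 1 ?c] pos by simp
    \<comment> \<open>Since distances are at most 1, a counterexample has violation even below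
      \<open>?c / 16\<close>.\<close>
    with u_bad viol_pos have few: "viol u < ?c / 4"
      by simp
    obtain G where G: "G \<in> V \<rightarrow>\<^sub>E \<Sigma>" "?c * hdist V u G \<le> 4 * viol u" "8 * viol G \<le> viol u"
      unfolding viol_def
      by (rule correction_step[OF assms(1,2) pos assms(7,8,9,10,11,13) local_distance
          local_local_testability uV few[unfolded viol_def]])
    \<comment> \<open>Otherwise minimality would give
      \<open>viol u \<le> viol G \<le> viol u / 8\<close>, against \<open>viol_pos\<close>.\<close>
    have "G \<notin> Bad"
      using u(2)[of G] G(3) viol_pos by auto
    then have "?c * hdist_code V G ?C \<le> 16 * viol G"
      using G(1) by (simp add: Bad_def)
    moreover have "?c * hdist_code V u ?C \<le> ?c * (hdist V u G + hdist_code V G ?C)"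
      using hdist_code_triangle[OF assms(1) finC assms(13)] pos by (intro mult_left_mono) auto
    \<comment> \<open>The total is at most \<open>4 * viol u + 16 * viol u / 8 = 6 * viol u\<close>,
      less than the \<open>16 * viol u\<close> that a counterexample exceeds.\<close>
    ultimately show False
      using u_bad G(2,3) viol_pos by (simp add: distrib_left)
  qed
  show ?thesis
    unfolding locally_testable_def
  proof
    fix w assume "w \<in> V \<rightarrow>\<^sub>E \<Sigma>"
    from bound[OF this] show "?c / 16 * hdist_code V w ?C \<le>
        measure_pmf.prob (map_pmf t_of P) {t. restrict w t \<notin> B t}"
      by (simp add: viol_def vimage_def)
  qed
qed

end
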